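(* Let $L$ be an $n$-dimensional single-generated Leibniz algebra over $F$, $n\ge 1$. Then $L$ admits a basis $\{x_1,\dots,x_n\}$ such that, for some scalars $a_2,\dots,a_n\in F$, the multiplication table of $L$ in this basis is that of $\mu_1(a_2,\dots,a_n)$, i.e. $$[x_i,x_1]=x_{i+1}\ (1\le i\le n-1),\qquad [x_n,x_1]=\sum_{k=2}^n a_kx_k,$$ all other products of basis elements being zero.
   Context: $F$ is a field of characteristic zero. A (right) Leibniz algebra is an algebra $L$ with bilinear product $[-,-]$ satisfying $[x,[y,z]]=[[x,y],z]-[[x,z],y]$ for all $x,y,z$. It is single-generated if it is generated as an algebra by one element. $\mu_1(a_2,\dots,a_n)$ denotes the algebra with basis $x_1,\dots,x_n$ and the multiplication table displayed in the claim. *)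

theory Defs
  imports Complex_Main
begin

definition (in vector_space) basis_family :: "nat \<Rightarrow> (nat \<Rightarrow> 'b) \<Rightarrow> bool" where
  "basis_family n x \<longleftrightarrow>
     inj_on x {1..n} \<and> independent (x ` {1..n}) \<and> span (x ` {1..n}) = UNIV"

locale leibniz_algebra = vector_space scale
  for scale :: "'a::field \<Rightarrow> 'b::ab_group_add \<Rightarrow> 'b" +
  fixes br :: "'b \<Rightarrow> 'b \<Rightarrow> 'b"
  assumes linear_left: "Vector_Spaces.linear scale scale (\<lambda>x. br x y)"
    and linear_right: "Vector_Spaces.linear scale scale (\<lambda>y. br x y)"
    and right_leibniz: "br x (br y z) = br (br x y) z - br (br x z) y"
begin

definition subalgebra :: "'b set \<Rightarrow> bool" where
  "subalgebra S \<longleftrightarrow> subspace S \<and> (\<forall>x\<in>S. \<forall>y\<in>S. br x y \<in> S)"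

definition single_generated :: bool where
  "single_generated \<longleftrightarrow> (\<exists>g. subalgebra hull {g} = UNIV)"

definition mu1_table :: "nat \<Rightarrow> (nat \<Rightarrow> 'a) \<Rightarrow> (nat \<Rightarrow> 'b) \<Rightarrow> bool" where
  "mu1_table n a x \<longleftrightarrow>
     (\<forall>i\<in>{1..<n}. br (x i) (x 1) = x (i + 1)) \<and>
     br (x n) (x 1) = (\<Sum>k=2..n. scale (a k) (x k)) \<and>
     (\<forall>i\<in>{1..n}. \<forall>j\<in>{2..n}. br (x i) (x j) = 0)"

end

end

theory Submission
  imports Defs
begin

text \<open>
  Let \<open>g\<close> generate \<open>L\<close> and let \<open>R = [-, g]\<close>. The Leibniz identity gives
  \<open>[x, [g, g]] = 0\<close> and, inductively, \<open>[x, R\<^sup>i g] = 0\<close> for all \<open>i \<ge> 1\<close>. Hence the span of the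
  orbit \<open>g, R g, R\<^sup>2 g, \<dots>\<close> is already a subalgebra, i.e. \<open>g\<close> is a cyclic vector of \<open>R\<close> and
  \<open>g, \<dots>, R\<^bsup>n-1\<^esup> g\<close> is a basis. If \<open>R\<^sup>n g\<close> has coefficient \<open>c\<close> at \<open>g\<close>, applying
  \<open>[g, -]\<close> gives \<open>c R g = 0\<close>; so \<open>c = 0\<close>, unless \<open>R g = 0\<close>, in which case \<open>R\<^sup>n g = 0\<close>.
\<close>

context vector_space
begin

lemma independent_sequence:
  fixes y :: "nat \<Rightarrow> 'b"
  assumes "\<And>k. k < m \<Longrightarrow> y k \<notin> span (y ` {..<k})"
  shows "inj_on y {..<m} \<and> independent (y ` {..<m})"
  using assms
proof (induction m)
  case 0
  show ?case by (simp add: independent_empty)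
next
  case (Suc m)
  then have IH: "inj_on y {..<m}" "independent (y ` {..<m})" and new: "y m \<notin> span (y ` {..<m})"
    by simp_all
  from new have "y m \<notin> y ` {..<m}"
    by (meson span_base)
  with IH new show ?case
    by (auto simp: lessThan_Suc independent_insertI)
qed

text \<open>Take the least \<open>m\<close> for which \<open>R^m g\<close> depends on the earlier
  iterates. The span of the first \<open>m\<close> iterates is then invariant under \<open>R\<close>
  and contains \<open>g\<close>, so it is the whole space; minimality gives independence, and
  counting dimensions gives \<open>m = n\<close>.\<close>

lemma cyclic_vector_basis:
  assumes lin: "Vector_Spaces.linear scale scale R"
    and cyclic: "span (range (\<lambda>i. (R ^^ i) g)) = UNIV"
    and dim: "dim (UNIV :: 'b set) = n" "n \<ge> 1"
  shows "inj_on (\<lambda>i. (R ^^ i) g) {..<n} \<and> independent ((\<lambda>i. (R ^^ i) g) ` {..<n})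
    \<and> span ((\<lambda>i. (R ^^ i) g) ` {..<n}) = UNIV"
proof -
  define y where "y = (\<lambda>i. (R ^^ i) g)"
  obtain B :: "'b set" where B: "independent B" "span B = UNIV" "card B = n"
    using basis_exists[of UNIV] dim(1) by (metis top.extremum_unique)
  \<comment> \<open>An infinite \<open>B\<close> would have \<open>card B = 0\<close>, so
    \<open>n \<ge> 1\<close> is what excludes infinite dimension here.\<close>
  then have "finite B"
    using dim(2) by (auto intro: card_ge_0_finite)
  have "\<exists>k. y k \<in> span (y ` {..<k})"
  proof (rule ccontr)
    assume "\<nexists>k. y k \<in> span (y ` {..<k})"
    then have ind: "inj_on y {..<Suc n}" "independent (y ` {..<Suc n})"
      using independent_sequence[of "Suc n" y] by auto
    then have "card (y ` {..<Suc n}) \<le> card B"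
      using independent_span_bound[OF \<open>finite B\<close>] B(2) by auto
    with ind(1) B(3) show False
      by (simp add: card_image)
  qed
  then obtain m where m: "y m \<in> span (y ` {..<m})" "\<And>k. k < m \<Longrightarrow> y k \<notin> span (y ` {..<k})"
    using exists_least_iff[of "\<lambda>k. y k \<in> span (y ` {..<k})"] by blast
  let ?S = "span (y ` {..<m})"
  have step: "R (y i) = y (Suc i)" for i
    by (simp add: y_def)
  have "R ` ?S = span (R ` y ` {..<m})"
    using module_hom.span_image[OF module_hom_linearI[OF lin]] by simp
  moreover have "R ` y ` {..<m} \<subseteq> ?S"
  proof (clarsimp simp: step)
    fix i assume "i < m"
    then show "y (Suc i) \<in> ?S"
      using m(1) by (cases "Suc i = m") (auto intro: span_base)
  qed
  ultimately have invariant: "R ` ?S \<subseteq> ?S"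
    by (simp add: span_minimal)
  have "y i \<in> ?S" for i
  proof (induction i)
    case 0
    show ?case using m(1) by (cases "m = 0") (auto intro: span_base)
  next
    case (Suc i)
    then show ?case using invariant step by auto
  qed
  then have "span (range y) \<subseteq> ?S"
    by (intro span_minimal) auto
  then have spanning: "?S = UNIV"
    using cyclic by (auto simp: y_def)
  have ind: "inj_on y {..<m}" "independent (y ` {..<m})"
    using independent_sequence m(2) by auto
  have "m = n"
    using dim_eq_card[of "y ` {..<m}" UNIV] spanning ind dim(1) by (simp add: card_image)
  with ind spanning show ?thesis
    by (simp add: y_def)
qed

text \<open>Injectivity of \<open>x\<close> lets coefficients attached to vectors be reindexed as
  coefficients attached to indices.\<close>

lemma span_image_finite_sum:
  assumes "finite I" "inj_on x I" "v \<in> span (x ` I)"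
  obtains c where "v = (\<Sum>i\<in>I. scale (c i) (x i))"
proof -
  obtain u where "v = (\<Sum>w\<in>x ` I. scale (u w) w)"
    using assms by (auto simp: span_finite)
  also have "\<dots> = (\<Sum>i\<in>I. scale (u (x i)) (x i))"
    using assms(2) by (simp add: sum.reindex)
  finally show ?thesis
    by (rule that)
qed

end

context leibniz_algebra
begin

sublocale left: module_hom scale scale "\<lambda>x. br x y" for y
  using linear_left by (rule module_hom_linearI)

sublocale right: module_hom scale scale "br x" for x
  using linear_right by (rule module_hom_linearI)

text \<open>For \<open>i = 0\<close> the two terms of the Leibniz identity coincide and cancel. The
  induction keeps \<open>x\<close> arbitrary because the step uses the hypothesis both at
  \<open>x\<close> and at \<open>br x g\<close>.\<close>

lemma br_right_power_eq_0: "br x (((\<lambda>z. br z g) ^^ Suc i) g) = 0"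
proof (induction i arbitrary: x)
  case 0
  show ?case by (simp add: right_leibniz)
next
  case (Suc i)
  let ?p = "((\<lambda>z. br z g) ^^ Suc i) g"
  have "br x (br ?p g) = br (br x ?p) g - br (br x g) ?p"
    by (rule right_leibniz)
  also have "\<dots> = 0"
    using Suc.IH by (simp del: funpow.simps)
  finally show ?case
    by simp
qed

lemma span_right_powers_eq_UNIV:
  assumes "subalgebra hull {g} = UNIV"
  shows "span (range (\<lambda>i. ((\<lambda>z. br z g) ^^ i) g)) = UNIV"
proof -
  define y where "y = (\<lambda>i. ((\<lambda>z. br z g) ^^ i) g)"
  let ?S = "span (range y)"
  have y_0: "y 0 = g" and y_Suc: "y (Suc i) = br (y i) g" for i
    by (simp_all add: y_def)
  have mult: "br (y i) (y j) \<in> ?S" for i j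
  proof (cases j)
    case 0
    then show ?thesis using y_Suc[of i] y_0 by (metis rangeI span_base)
  next
    case (Suc k)
    then show ?thesis using br_right_power_eq_0[of "y i" k g] by (simp add: y_def span_zero)
  qed
  \<comment> \<open>Closure extends from the orbit to its span one argument at a time, first on the
    left, then on the right.\<close>
  have spanned: "br u (y j) \<in> ?S" if "u \<in> ?S" for u j
    using that
    by (induction rule: span_induct_alt)
      (auto simp: left.add left.scale mult intro!: span_zero span_add span_scale)
  have "br u v \<in> ?S" if "u \<in> ?S" "v \<in> ?S" for u v
    using that(2)
  proof (induction rule: span_induct_alt)
    case base
    show ?case by (simp add: span_zero)
  next
    case (step c w z)
    with that(1) spanned show ?case
      by (auto simp: right.add right.scale intro!: span_add span_scale)
  qed
  then have "subalgebra ?S"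
    by (simp add: subalgebra_def)
  moreover have "{g} \<subseteq> ?S"
    using y_0 by (metis empty_subsetI insert_subset rangeI span_base)
  ultimately have "subalgebra hull {g} \<subseteq> ?S"
    by (simp add: hull_minimal)
  then show ?thesis
    using assms by (auto simp: y_def)
qed

end

theorem proposition3p6:
  fixes scale :: "'a::field_char_0 \<Rightarrow> 'b::ab_group_add \<Rightarrow> 'b"
    and br :: "'b \<Rightarrow> 'b \<Rightarrow> 'b"
    and n :: nat
  assumes "leibniz_algebra scale br"
    and "n \<ge> 1"
    and "vector_space.dim scale (UNIV :: 'b set) = n"
    and "leibniz_algebra.single_generated scale br"
  shows "\<exists>x a. vector_space.basis_family scale n x \<and> leibniz_algebra.mu1_table scale br n a x"
proof -
  interpret leibniz_algebra scale br by fact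
  obtain g where g: "subalgebra hull {g} = UNIV"
    using assms(4) by (auto simp: single_generated_def)
  define y where "y = (\<lambda>i. ((\<lambda>z. br z g) ^^ i) g)"
  \<comment> \<open>Powers count from 0 and the basis from 1, so \<open>x 1 = g\<close> and
    \<open>y n\<close> is the vector just after the last basis element \<open>x n\<close>.\<close>
  define x where "x = (\<lambda>i. y (i - 1))"
  have y_0: "y 0 = g" and y_Suc: "y (Suc i) = br (y i) g" for i
    by (simp_all add: y_def)
  have br_y_Suc: "br v (y (Suc i)) = 0" for v i
    using br_right_power_eq_0 by (simp add: y_def)
  have basis: "inj_on y {..<n}" "independent (y ` {..<n})" "span (y ` {..<n}) = UNIV"
    using cyclic_vector_basis[OF linear_left span_right_powers_eq_UNIV[OF g] assms(3,2)]
    by (auto simp: y_def)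
  have shift: "bij_betw (\<lambda>i. i - 1) {1..n} {..<n}"
    by (rule bij_betw_byWitness[where f' = Suc]) auto
  then have image: "x ` {1..n} = y ` {..<n}"
    unfolding x_def bij_betw_def by (metis image_image)
  have "inj_on x {1..n}"
    using comp_inj_on[of "\<lambda>i. i - 1" "{1..n}" y] shift basis(1)
    by (simp add: x_def bij_betw_def comp_def)
  with basis image have family: "basis_family n x"
    by (simp add: basis_family_def)
  have "\<exists>a. y n = (\<Sum>k=2..n. scale (a k) (x k))"
  \<comment> \<open>Bracketing with \<open>g\<close> only shows that \<open>a 1\<close> times
    \<open>y 1\<close> vanishes, so \<open>y 1 = 0\<close> is treated apart.\<close>
  proof (cases "y 1 = 0")
    case True
    have "y (Suc i) = 0" for i
      by (induction i) (use True y_Suc in simp_all)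
    then have "y n = 0"
      using assms(2) by (metis Suc_le_D One_nat_def)
    then show ?thesis
      by (intro exI[of _ "\<lambda>_. 0"]) simp
  next
    case False
    obtain a where "y n = (\<Sum>k\<in>{1..n}. scale (a k) (x k))"
      using span_image_finite_sum[of "{1..n}" x "y n"] family
      by (auto simp: basis_family_def)
    also have "{1..n} = insert 1 {2..n}"
      using assms(2) by auto
    finally have a: "y n = scale (a 1) g + (\<Sum>k=2..n. scale (a k) (x k))"
      by (simp add: x_def y_0)
    \<comment> \<open>For \<open>k \<ge> 2\<close>, \<open>x k\<close> is a positive power applied
      to \<open>g\<close>, hence annihilated as a right factor; only the \<open>g\<close> term
      survives in \<open>br g (y n)\<close>.\<close>
    have "br g (x k) = 0" if "k \<in> {2..n}" for k
      using br_y_Suc[of g "k - 2"] that by (simp add: x_def numeral_2_eq_2 Suc_diff_Suc)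
    then have "br g (y n) = scale (a 1) (y 1)"
      by (simp add: a right.add right.scale right.sum y_Suc y_0)
    moreover have "br g (y n) = 0"
      using br_y_Suc[of g "n - 1"] assms(2) by simp
    ultimately have "a 1 = 0"
      using False by simp
    with a show ?thesis
      by auto
  qed
  then obtain a where a: "y n = (\<Sum>k=2..n. scale (a k) (x k))"
    by blast
  have x_1: "x 1 = g"
    by (simp add: x_def y_0)
  \<comment> \<open>This covers both table rows: \<open>y i\<close> is \<open>x (i + 1)\<close> for
    \<open>i < n\<close>, and for \<open>i = n\<close> it is the sum found above.\<close>
  have next_x: "br (x i) (x 1) = y i" if "i \<ge> 1" for i
    using y_Suc[of "i - 1"] that by (simp add: x_def y_0)
  have "br (x i) (x j) = 0" if "j \<ge> 2" for i j
    using br_y_Suc[of "x i" "j - 2"] that by (simp add: x_def numeral_2_eq_2 Suc_diff_Suc)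
  with next_x a assms(2) have "mu1_table n a x"
    by (auto simp: mu1_table_def x_def)
  with family show ?thesis
    by blast
qed

end
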